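(* Let $P$ and $E$ be $n\times n$ row stochastic matrices, let $0\leq c\leq 1$, and assume that $E$ has rank $1$. Let $\lambda_1,\ldots,\lambda_n\in\mathbb{C}$ be the eigenvalues of $cP+(1-c)E$, counted with algebraic multiplicity and ordered so that $1=\lambda_1\geq|\lambda_2|\geq\cdots\geq|\lambda_n|$. If the vector space $\{y\in\mathbb{R}^n : y=Py\}$ has dimension greater than one, then $|\lambda_2|=c$. In fact, the ordering of the eigenvalues (with $\lambda_1=1$ and nonincreasing moduli) can be chosen so that $\lambda_2=c$.
   Context: A real $n\times n$ matrix $B=(b_{ij})$ is row stochastic if $b_{ij}\ge 0$ for all $i,j$ and $\sum_{j=1}^n b_{ij}=1$ for every $1\le i\le n$. Elements of $\mathbb{R}^n$ are column vectors. *)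

theory Defs
  imports
    Complex_Main
    "HOL-Computational_Algebra.Polynomial"
    "Jordan_Normal_Form.Char_Poly"
    "Jordan_Normal_Form.DL_Rank"
begin

definition row_stochastic :: "nat \<Rightarrow> real mat \<Rightarrow> bool" where
  "row_stochastic n B \<longleftrightarrow> B \<in> carrier_mat n n \<and>
     (\<forall>i<n. \<forall>j<n. B $$ (i, j) \<ge> 0) \<and> (\<forall>i<n. (\<Sum>j<n. B $$ (i, j)) = 1)"

definition complex_eigenvalues :: "real mat \<Rightarrow> complex multiset" where
  "complex_eigenvalues A = proots (char_poly (map_mat complex_of_real A))"

(* Lists are indexed from 0: ls ! 0 is \<lambda>_1 and ls ! 1 is \<lambda>_2. *)
definition eigenvalue_ordering :: "real mat \<Rightarrow> complex list \<Rightarrow> bool" where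
  "eigenvalue_ordering A ls \<longleftrightarrow> mset ls = complex_eigenvalues A \<and>
     ls \<noteq> [] \<and> ls ! 0 = 1 \<and> sorted_wrt (\<lambda>x y. cmod x \<ge> cmod y) ls"

(* The subspace {y \<in> R^n. y = P y}, as a vector space in the sense of HOL-Algebra. *)
definition fixed_space :: "nat \<Rightarrow> real mat \<Rightarrow> (real, real vec) module" where
  "fixed_space n P =
     (module_vec TYPE(real) n) \<lparr>carrier := {y \<in> carrier_vec n. y = P *\<^sub>v y}\<rparr>"

end

theory Submission
  imports Defs
begin

text \<open>
  Let \<open>e\<close> be the all-ones vector. A matrix \<open>A\<close> with \<open>A e = e\<close> acts on the quotient of the space by
  the line through \<open>e\<close>; in the coordinates in which the first entry is normalised to 0 this action
  is the deflated matrix \<open>A'\<close> with entries \<open>a\<^sub>i\<^sub>j - a\<^sub>0\<^sub>j\<close> (\<open>i, j \<ge> 1\<close>), and the eigenvalues of \<open>A\<close> are 1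
  together with those of \<open>A'\<close>. All rows of a row stochastic matrix \<open>E\<close> of rank 1 agree, so \<open>E' = 0\<close>
  and \<open>(c P + (1 - c) E)' = c P'\<close>. The eigenvalues of \<open>P'\<close> have modulus at most 1, and a second fixed
  vector of \<open>P\<close> survives in the quotient, so that \<open>c\<close> is an eigenvalue of \<open>c P'\<close> of maximal modulus.
\<close>

section \<open>Deflation along the all-ones vector\<close>

definition deflate :: "nat \<Rightarrow> 'a :: ab_group_add mat \<Rightarrow> 'a mat" where
  "deflate m A = mat m m (\<lambda>(i, j). A $$ (Suc i, Suc j) - A $$ (0, Suc j))"

lemma deflate_carrier [simp]: "deflate m A \<in> carrier_mat m m"
  by (simp add: deflate_def)

lemma deflate_dim [simp]: "dim_row (deflate m A) = m" "dim_col (deflate m A) = m"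
  by (simp_all add: deflate_def)

lemma deflate_index [simp]:
  "i < m \<Longrightarrow> j < m \<Longrightarrow> deflate m A $$ (i, j) = A $$ (Suc i, Suc j) - A $$ (0, Suc j)"
  by (simp add: deflate_def)

text \<open>In the basis formed by the all-ones vector and the unit vectors other than the zeroth,
  \<open>A\<close> becomes block upper triangular with diagonal blocks 1 and
  \<open>deflate m A\<close>.\<close>

lemma char_poly_deflate:
  fixes A :: "'a :: field mat"
  assumes A: "A \<in> carrier_mat (Suc m) (Suc m)"
    and rows: "\<And>i. i < Suc m \<Longrightarrow> (\<Sum>j<Suc m. A $$ (i, j)) = 1"
  shows "char_poly A = [:-1, 1:] * char_poly (deflate m A)"
proof -
  define n where "n = Suc m"
  \<comment> \<open>The columns of \<open>S\<close> are that basis. Its inverse \<open>T\<close>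
    subtracts the zeroth coordinate of a vector from each of the others.\<close>
  define S where "S = mat n n (\<lambda>(i, j). if j = 0 \<or> i = j then 1 else 0 :: 'a)"
  define T where "T = mat n n (\<lambda>(i, j). if i = j then 1 else if j = 0 then -1 else 0 :: 'a)"
  define B1 where "B1 = mat 1 1 (\<lambda>_. 1 :: 'a)"
  define B2 where "B2 = mat 1 m (\<lambda>(i, j). A $$ (0, Suc j))"
  define B where "B = four_block_mat B1 B2 (0\<^sub>m m 1) (deflate m A)"
  have A': "A \<in> carrier_mat n n" using A by (simp add: n_def)
  have S: "S \<in> carrier_mat n n" and T: "T \<in> carrier_mat n n"
    by (auto simp: S_def T_def)
  have B1: "B1 \<in> carrier_mat 1 1" and B2: "B2 \<in> carrier_mat 1 m"
    by (auto simp: B1_def B2_def)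
  have B: "B \<in> carrier_mat n n"
    unfolding B_def n_def using four_block_carrier_mat[OF B1, of "deflate m A" m m] by simp
  have ST: "S * T = 1\<^sub>m n"
  proof (rule eq_matI)
    fix i j assume "i < dim_row (1\<^sub>m n :: 'a mat)" "j < dim_col (1\<^sub>m n :: 'a mat)"
    then have ij: "i < Suc m" "j < Suc m" by (auto simp: n_def)
    have "(S * T) $$ (i, j) = (\<Sum>k = 0..<Suc m. S $$ (i, k) * T $$ (k, j))"
      using ij by (simp add: S_def T_def n_def scalar_prod_def del: sum.op_ivl_Suc)
    \<comment> \<open>Column 0 of \<open>S\<close> contains only ones, so the summand
      \<open>k = 0\<close> is always present. Among the others only \<open>k = i\<close> survives,
      and none does if \<open>i = 0\<close>. The product \<open>S * B\<close> below is computed in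
      the same way.\<close>
    also have "\<dots> = T $$ (0, j) + (\<Sum>k = 0..<m. S $$ (i, Suc k) * T $$ (Suc k, j))"
      using ij by (subst sum.atLeast0_lessThan_Suc_shift) (simp add: S_def n_def)
    also have "(\<Sum>k = 0..<m. S $$ (i, Suc k) * T $$ (Suc k, j)) =
        (\<Sum>k = 0..<m. if Suc k = i then T $$ (i, j) else 0)"
      using ij by (intro sum.cong) (auto simp: S_def n_def)
    also have "\<dots> = (if i = 0 then 0 else T $$ (i, j))"
      using ij by (cases i) auto
    finally show "(S * T) $$ (i, j) = 1\<^sub>m n $$ (i, j)"
      using ij by (auto simp: T_def n_def)
  qed (auto simp: S_def T_def)
  have TS: "T * S = 1\<^sub>m n"
    by (rule mat_mult_left_right_inverse[OF S T ST])
  have "A * S = S * B"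
  proof (rule eq_matI)
    fix i j assume "i < dim_row (S * B)" "j < dim_col (S * B)"
    then have ij: "i < Suc m" "j < Suc m" using S B by (auto simp: n_def)
    have L: "(A * S) $$ (i, j) = (\<Sum>k = 0..<Suc m. A $$ (i, k) * S $$ (k, j))"
      using ij A by (simp add: S_def n_def scalar_prod_def del: sum.op_ivl_Suc)
    have "(S * B) $$ (i, j) = (\<Sum>k = 0..<Suc m. S $$ (i, k) * B $$ (k, j))"
      using ij B by (simp add: S_def n_def scalar_prod_def del: sum.op_ivl_Suc)
    also have "\<dots> = B $$ (0, j) + (\<Sum>k = 0..<m. S $$ (i, Suc k) * B $$ (Suc k, j))"
      using ij by (subst sum.atLeast0_lessThan_Suc_shift) (simp add: S_def n_def)
    also have "(\<Sum>k = 0..<m. S $$ (i, Suc k) * B $$ (Suc k, j)) =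
        (\<Sum>k = 0..<m. if Suc k = i then B $$ (i, j) else 0)"
      using ij by (intro sum.cong) (auto simp: S_def n_def)
    also have "\<dots> = (if i = 0 then 0 else B $$ (i, j))"
      using ij by (cases i) auto
    finally have R: "(S * B) $$ (i, j) = B $$ (0, j) + (if i = 0 then 0 else B $$ (i, j))" .
    show "(A * S) $$ (i, j) = (S * B) $$ (i, j)"
    proof (cases j)
      case 0
      \<comment> \<open>Column 0 of \<open>A * S\<close> consists of the row sums of
        \<open>A\<close>; these being 1 is what makes the lower left block of \<open>B\<close>
        vanish.\<close>
      have "(A * S) $$ (i, j) = (\<Sum>k<Suc m. A $$ (i, k))"
        unfolding L using 0 by (intro sum.cong) (auto simp: S_def n_def)
      with rows[OF ij(1)] show ?thesis
        unfolding R using 0 ij by (auto simp: B_def B1_def)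
    next
      case (Suc j')
      have "(A * S) $$ (i, j) = (\<Sum>k = 0..<Suc m. if k = j then A $$ (i, j) else 0)"
        unfolding L using Suc ij by (intro sum.cong) (auto simp: S_def n_def)
      also have "\<dots> = A $$ (i, j)"
        using ij by (subst sum.delta) auto
      finally show ?thesis
        unfolding R using Suc ij by (cases i) (auto simp: B_def B1_def B2_def)
    qed
  qed (use A' S B in auto)
  then have "A = S * B * T"
    using A' S T ST by (metis assoc_mult_mat right_mult_one_mat)
  then have "similar_mat A B"
    using A' B S T ST TS by (intro similar_matI[of _ _ S T n]) auto
  then have "char_poly A = char_poly B"
    by (rule char_poly_similar)
  also have "\<dots> = char_poly B1 * char_poly (deflate m A)"
    unfolding B_def by (rule char_poly_four_block_zeros_col[OF B1 B2]) simp
  also have "char_poly B1 = [:-1, 1:]"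
    by (simp add: B1_def char_poly_defs det_def sign_def)
  finally show ?thesis .
qed

section \<open>The spectral bound for row stochastic matrices\<close>

text \<open>Look at a coordinate \<open>k\<close> where the eigenvector has its largest modulus
  \<open>M\<close>: row \<open>k\<close> forms a convex combination of numbers of modulus at most
  \<open>M\<close>, so \<open>cmod \<mu> * M \<le> M\<close>.\<close>

lemma row_stochastic_eigenvalue_norm_le_1:
  assumes P: "row_stochastic n P"
    and ev: "eigenvalue (map_mat complex_of_real P) \<mu>"
  shows "cmod \<mu> \<le> 1"
proof -
  have Pc: "P \<in> carrier_mat n n" and nonneg: "\<And>i j. i < n \<Longrightarrow> j < n \<Longrightarrow> P $$ (i, j) \<ge> 0"
    and rows: "\<And>i. i < n \<Longrightarrow> (\<Sum>j<n. P $$ (i, j)) = 1"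
    using P by (auto simp: row_stochastic_def)
  obtain v where v: "v \<in> carrier_vec n" "v \<noteq> 0\<^sub>v n"
    and eq: "map_mat complex_of_real P *\<^sub>v v = \<mu> \<cdot>\<^sub>v v"
    using ev Pc by (auto simp: eigenvalue_def eigenvector_def)
  obtain l where l: "l < n" "v $ l \<noteq> 0"
    using v by (metis carrier_vecD eq_vecI index_zero_vec)
  define M where "M = Max ((\<lambda>i. cmod (v $ i)) ` {..<n})"
  have le: "cmod (v $ i) \<le> M" if "i < n" for i
    unfolding M_def using that by (intro Max_ge) auto
  have "M \<in> (\<lambda>i. cmod (v $ i)) ` {..<n}"
    unfolding M_def using l by (intro Max_in) auto
  then obtain k where k: "k < n" "M = cmod (v $ k)" by auto
  have "M > 0" using le[OF l(1)] l(2) by (meson less_le_trans zero_less_norm_iff)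
  have "\<mu> * v $ k = (\<mu> \<cdot>\<^sub>v v) $ k" using k v by simp
  also have "\<dots> = (\<Sum>j<n. complex_of_real (P $$ (k, j)) * v $ j)"
    unfolding eq[symmetric] using k v Pc
    by (auto simp: scalar_prod_def lessThan_atLeast0 intro!: sum.cong)
  finally have "cmod \<mu> * M = cmod (\<Sum>j<n. complex_of_real (P $$ (k, j)) * v $ j)"
    using k by (metis norm_mult)
  also have "\<dots> \<le> (\<Sum>j<n. P $$ (k, j) * M)"
    using k nonneg le by (intro sum_norm_le) (auto simp: norm_mult intro!: mult_mono)
  also have "\<dots> = M" using rows[OF k(1)] by (simp flip: sum_distrib_right)
  finally show ?thesis using \<open>M > 0\<close> by simp
qed

section \<open>Row stochastic matrices of rank 1\<close>

text \<open>Every column is a multiple \<open>a k\<close> of one nonzero column \<open>w\<close>.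
  The sum of row \<open>r\<close> is then \<open>w $ r\<close> times the sum of all
  \<open>a k\<close>; as it equals 1 for every \<open>r\<close>, the vector \<open>w\<close> is
  constant.\<close>

lemma rank_1_row_stochastic_rows_equal:
  assumes E: "row_stochastic n E" and rank: "vec_space.rank n E = 1"
    and ij: "i < n" "j < n"
  shows "E $$ (i, j) = E $$ (0, j)"
proof -
  interpret vec_space "TYPE(real)" n .
  have Ec: "E \<in> carrier_mat n n" and rows: "\<And>i. i < n \<Longrightarrow> (\<Sum>j<n. E $$ (i, j)) = 1"
    using E by (auto simp: row_stochastic_def)
  have "n > 0" using ij by simp
  \<comment> \<open>A row with sum 1 cannot vanish, so some column has a nonzero entry in row 0;
    this column serves as \<open>w\<close>.\<close>
  obtain l where l: "l < n" "E $$ (0, l) \<noteq> 0"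
    using rows[OF \<open>n > 0\<close>] by (metis lessThan_iff sum.neutral zero_neq_one)
  define w where "w = col E l"
  have w: "w \<in> carrier_vec n" using Ec l by (simp add: w_def)
  have w0: "w \<noteq> 0\<^sub>v n" using l Ec \<open>n > 0\<close> by (metis carrier_matD index_col index_zero_vec(1) w_def)
  have col_in: "col E k \<in> set (cols E)" if "k < n" for k
    using that Ec by (metis carrier_matD(2) cols_length cols_nth nth_mem)
  have indpt: "lin_indpt {w}"
  proof -
    have "lin_indpt {}" by (simp add: lin_dep_def)
    then show ?thesis
      using lin_dep_iff_in_span[of "{}" w] w w0 span_empty by auto
  qed
  have "\<exists>a. col E k = a \<cdot>\<^sub>v w" if k: "k < n" for k
  proof -
    have kc: "col E k \<in> carrier_vec n" using Ec k by simp
    have "col E k \<in> span {w}"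
    \<comment> \<open>Otherwise \<open>w\<close> and column \<open>k\<close> would be two distinct,
      linearly independent columns, against rank 1.\<close>
    proof (rule ccontr)
      assume nin: "col E k \<notin> span {w}"
      then have ne: "col E k \<noteq> w" using w span_mem[of "{w}" w] by auto
      have "lin_indpt ({w} \<union> {col E k})"
        using lin_dep_iff_in_span[of "{w}" "col E k"] nin indpt w kc ne by auto
      moreover have "{w} \<union> {col E k} \<subseteq> set (cols E)"
        using col_in k l by (auto simp: w_def)
      ultimately have "card ({w} \<union> {col E k}) \<le> rank E"
        by (intro rank_ge_card_indpt[OF Ec])
      then show False using rank ne by auto
    qed
    then obtain a where "col E k = lincomb a {w}"
      using finite_in_span[of "{w}" "col E k"] w
      by (metis empty_subsetI finite.emptyI finite.insertI insert_subset module_vec_simps(3))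
    then show ?thesis using w by (auto simp: lincomb_def)
  qed
  then obtain a where a: "\<And>k. k < n \<Longrightarrow> col E k = a k \<cdot>\<^sub>v w" by metis
  have entry: "E $$ (r, k) = a k * w $ r" if "r < n" "k < n" for r k
  proof -
    have "E $$ (r, k) = col E k $ r" using that Ec by simp
    then show ?thesis using that w a by simp
  qed
  have "(\<Sum>k<n. a k) * w $ r = 1" if "r < n" for r
    using rows[OF that] entry[OF that] by (simp add: sum_distrib_right)
  from this[OF ij(1)] this[OF \<open>n > 0\<close>] have "w $ i = w $ 0"
    by (metis mult_cancel_left mult_zero_left zero_neq_one)
  then show ?thesis using entry ij \<open>n > 0\<close> by simp
qed

section \<open>The fixed space of \<open>P\<close>\<close>

text \<open>If all fixed vectors were constant, the all-ones vector would span the fixed space,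
  whose dimension would be at most 1.\<close>

lemma fixed_space_nonconstant:
  assumes P: "row_stochastic n P"
    and dim: "vectorspace.dim class_ring (fixed_space n P) > 1"
  shows "\<exists>y i. y \<in> carrier_vec n \<and> P *\<^sub>v y = y \<and> i < n \<and> y $ i \<noteq> y $ 0"
proof (rule ccontr)
  assume nonconst: "\<not> ?thesis"
  then have const: "y $ i = y $ 0" if "y \<in> carrier_vec n" "P *\<^sub>v y = y" "i < n" for y i
    using that nonconst by blast
  interpret vec_space "TYPE(real)" n .
  define W where "W = {y \<in> carrier_vec n. y = P *\<^sub>v y}"
  define e where "e = vec n (\<lambda>_. 1 :: real)"
  have Pc: "P \<in> carrier_mat n n" and rows: "\<And>i. i < n \<Longrightarrow> (\<Sum>j<n. P $$ (i, j)) = 1"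
    using P by (auto simp: row_stochastic_def)
  \<comment> \<open>\<open>vs W\<close> is the structure \<open>fixed_space n P\<close>; it has to
    be a vector space before its dimension can be bounded by a generating set.\<close>
  have sub: "submodule class_ring W V"
    using Pc by unfold_locales
      (auto simp: W_def mult_add_distrib_mat_vec[of _ n n] mult_mat_vec[of _ n n])
  have "subspace class_ring W V"
    unfolding subspace_def using sub vectorspace_axioms by simp
  then have vs: "vectorspace class_ring (vs W)" by (rule subspace_is_vs)
  have "e = P *\<^sub>v e"
    using Pc rows by (intro eq_vecI) (auto simp: e_def scalar_prod_def lessThan_atLeast0)
  then have eW: "e \<in> W" by (simp add: W_def e_def)
  have "vectorspace.dim class_ring (vs W) \<le> 1"
  proof (rule vectorspace.dim_le1I[OF vs])
    interpret W: vectorspace class_ring "vs W" by (rule vs)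
    have "W.span {e} \<subseteq> W" using W.span_is_subset2[of "{e}"] eW by simp
    moreover have "W \<subseteq> W.span {e}"
    proof
      fix y assume y: "y \<in> W"
      then have yc: "y \<in> carrier_vec n" and yP: "P *\<^sub>v y = y" unfolding W_def by auto
      have "y $ 0 \<cdot>\<^sub>v e = y"
      proof (rule eq_vecI)
        fix i assume "i < dim_vec y"
        then have i: "i < n" using yc by simp
        then have "(y $ 0 \<cdot>\<^sub>v e) $ i = y $ 0" by (simp add: e_def)
        then show "(y $ 0 \<cdot>\<^sub>v e) $ i = y $ i" using const[OF yc yP i] by metis
      qed (use yc in \<open>simp add: e_def\<close>)
      moreover have "e \<in> W.span {e}" using eW by (intro W.span_mem) auto
      then have "y $ 0 \<cdot>\<^sub>v e \<in> W.span {e}"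
        using submodule.smult_closed[OF W.span_is_submodule[of "{e}"], of "y $ 0" e] eW by auto
      ultimately show "y \<in> W.span {e}" by argo
    qed
    ultimately show "W.gen_set {e}" by simp
  qed (use eW in auto)
  then show False using dim by (simp add: fixed_space_def W_def)
qed

section \<open>Eigenvalues under scaling and deflation\<close>

lemma eigenvalue_smult:
  assumes A: "A \<in> carrier_mat n n" and ev: "eigenvalue A (k :: 'a :: field)"
  shows "eigenvalue (c \<cdot>\<^sub>m A) (c * k)"
proof -
  obtain v where v: "v \<in> carrier_vec n" "v \<noteq> 0\<^sub>v n" "A *\<^sub>v v = k \<cdot>\<^sub>v v"
    using ev A by (auto simp: eigenvalue_def eigenvector_def)
  have "(c \<cdot>\<^sub>m A) *\<^sub>v v = (c * k) \<cdot>\<^sub>v v"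
  proof (rule eq_vecI)
    fix i assume "i < dim_vec ((c * k) \<cdot>\<^sub>v v)"
    then have i: "i < n" using v by simp
    have "((c \<cdot>\<^sub>m A) *\<^sub>v v) $ i = c * (A *\<^sub>v v) $ i"
      using i v(1) A by (simp add: scalar_prod_def sum_distrib_left mult.assoc)
    then show "((c \<cdot>\<^sub>m A) *\<^sub>v v) $ i = ((c * k) \<cdot>\<^sub>v v) $ i"
      unfolding v(3) using i v(1) by simp
  qed (use v A in auto)
  then show ?thesis using v A by (auto simp: eigenvalue_def eigenvector_def)
qed

lemma eigenvalue_zero_mat:
  assumes "eigenvalue (0\<^sub>m n n) (k :: 'a :: field)"
  shows "k = 0"
proof -
  obtain v where v: "v \<in> carrier_vec n" "v \<noteq> 0\<^sub>v n" "0\<^sub>m n n *\<^sub>v v = k \<cdot>\<^sub>v v"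
    using assms by (auto simp: eigenvalue_def eigenvector_def)
  have "0\<^sub>m n n *\<^sub>v v = 0\<^sub>v n"
    using v(1) by (intro eq_vecI) auto
  then have kv: "k \<cdot>\<^sub>v v = 0\<^sub>v n" using v(3) by simp
  obtain i where i: "i < n" "v $ i \<noteq> 0"
    using v(1,2) by (metis carrier_vecD eq_vecI index_zero_vec)
  have "k * v $ i = (k \<cdot>\<^sub>v v) $ i" using i v(1) by simp
  also have "\<dots> = 0" unfolding kv using i by simp
  finally have "k * v $ i = 0" .
  with \<open>v $ i \<noteq> 0\<close> show ?thesis by simp
qed

text \<open>For nonzero \<open>c\<close>, scaling back by \<open>inverse c\<close> turns
  \<open>k\<close> into an eigenvalue of \<open>A\<close>. For \<open>c = 0\<close> the matrix is
  zero and so is \<open>k\<close>.\<close>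

lemma eigenvalue_smult_norm_le:
  fixes A :: "'a :: real_normed_field mat"
  assumes A: "A \<in> carrier_mat n n" and bound: "\<And>l. eigenvalue A l \<Longrightarrow> norm l \<le> 1"
    and ev: "eigenvalue (c \<cdot>\<^sub>m A) k"
  shows "norm k \<le> norm c"
proof (cases "c = 0")
  case True
  have "c \<cdot>\<^sub>m A = 0\<^sub>m n n" using A True by (intro eq_matI) auto
  with ev show ?thesis using eigenvalue_zero_mat by fastforce
next
  case False
  have "inverse c \<cdot>\<^sub>m (c \<cdot>\<^sub>m A) = A" using A False by (intro eq_matI) auto
  then have "eigenvalue A (inverse c * k)"
    using eigenvalue_smult[OF smult_carrier_mat[OF A] ev, of "inverse c"] by simp
  from bound[OF this] show ?thesis using False by (simp add: norm_divide pos_divide_le_eq flip: divide_inverse_commute)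
qed

text \<open>The image of \<open>y\<close> in the quotient by the constant vectors has the
  coordinates \<open>y $ Suc j - y $ 0\<close>. It is fixed, and it is nonzero because
  \<open>y\<close> is not constant.\<close>

lemma eigenvalue_1_deflate:
  assumes A: "A \<in> carrier_mat (Suc m) (Suc m)" and y: "y \<in> carrier_vec (Suc m)"
    and rows: "\<And>i. i < Suc m \<Longrightarrow> (\<Sum>j<Suc m. A $$ (i, j)) = (1 :: 'a :: field)"
    and fixed: "A *\<^sub>v y = y" and i: "i < Suc m" "y $ i \<noteq> y $ 0"
  shows "eigenvalue (deflate m A) 1"
proof -
  define z where "z = vec m (\<lambda>j. y $ Suc j - y $ 0)"
  obtain i' where i': "i = Suc i'" using i by (cases i) auto
  have "z $ i' \<noteq> 0" using i i' by (simp add: z_def)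
  moreover have "i' < m" using i i' by simp
  ultimately have z0: "z \<noteq> 0\<^sub>v m" by auto
  \<comment> \<open>\<open>A\<close> fixes constant vectors, hence also \<open>y\<close> minus the
    constant \<open>y $ 0\<close>, whose zeroth coordinate vanishes and drops out of the
    sum.\<close>
  have row: "(\<Sum>j<m. A $$ (r, Suc j) * (y $ Suc j - y $ 0)) = y $ r - y $ 0" if "r < Suc m" for r
  proof -
    have "y $ r - y $ 0 = (A *\<^sub>v y) $ r - (\<Sum>j<Suc m. A $$ (r, j)) * y $ 0"
      using rows[OF that] fixed by simp
    also have "(A *\<^sub>v y) $ r = (\<Sum>j<Suc m. A $$ (r, j) * y $ j)"
      using that A y by (simp add: scalar_prod_def lessThan_atLeast0 del: sum.op_ivl_Suc)
    also have "\<dots> - (\<Sum>j<Suc m. A $$ (r, j)) * y $ 0 = (\<Sum>j<Suc m. A $$ (r, j) * (y $ j - y $ 0))"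
      by (simp add: sum_distrib_right sum_subtractf right_diff_distrib del: sum.lessThan_Suc)
    also have "\<dots> = (\<Sum>j<m. A $$ (r, Suc j) * (y $ Suc j - y $ 0))"
      by (subst sum.lessThan_Suc_shift) simp
    finally show ?thesis by simp
  qed
  have "deflate m A *\<^sub>v z = z"
  proof (rule eq_vecI)
    fix r assume "r < dim_vec z"
    then have r: "r < m" by (simp add: z_def)
    have "(deflate m A *\<^sub>v z) $ r =
        (\<Sum>j<m. (A $$ (Suc r, Suc j) - A $$ (0, Suc j)) * (y $ Suc j - y $ 0))"
      using r by (auto simp: deflate_def z_def scalar_prod_def lessThan_atLeast0 intro!: sum.cong)
    also have "\<dots> = (y $ Suc r - y $ 0) - (y $ 0 - y $ 0)"
      using r row[of "Suc r"] row[of 0] by (simp add: left_diff_distrib sum_subtractf)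
    finally show "(deflate m A *\<^sub>v z) $ r = z $ r" using r by (simp add: z_def)
  qed (simp add: z_def deflate_def)
  then have "eigenvector (deflate m A) z 1"
    using z0 by (simp add: eigenvector_def z_def deflate_def)
  then show ?thesis by (auto simp: eigenvalue_def)
qed

section \<open>The second eigenvalue of the combined matrix\<close>

lemma complex_row_sums:
  assumes "row_stochastic n P" "i < n"
  shows "(\<Sum>j<n. map_mat complex_of_real P $$ (i, j)) = 1"
proof -
  have "(\<Sum>j<n. map_mat complex_of_real P $$ (i, j)) = complex_of_real (\<Sum>j<n. P $$ (i, j))"
    unfolding of_real_sum using assms by (intro sum.cong) (auto simp: row_stochastic_def)
  also have "(\<Sum>j<n. P $$ (i, j)) = 1" using assms by (simp add: row_stochastic_def)
  finally show ?thesis by simp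
qed

theorem corollary2:
  fixes n :: nat and P E :: "real mat" and c :: real
  assumes "row_stochastic n P" and "row_stochastic n E"
    and "0 \<le> c" and "c \<le> 1"
    and "vec_space.rank n E = 1"
    and "vectorspace.dim class_ring (fixed_space n P) > 1"
  shows "(\<forall>ls. eigenvalue_ordering (c \<cdot>\<^sub>m P + (1 - c) \<cdot>\<^sub>m E) ls \<longrightarrow> cmod (ls ! 1) = c) \<and>
         (\<exists>ls. eigenvalue_ordering (c \<cdot>\<^sub>m P + (1 - c) \<cdot>\<^sub>m E) ls \<and> ls ! 1 = complex_of_real c)"
proof -
  define A where "A = c \<cdot>\<^sub>m P + (1 - c) \<cdot>\<^sub>m E"
  obtain y i where y: "y \<in> carrier_vec n" "P *\<^sub>v y = y" and i: "i < n" "y $ i \<noteq> y $ 0"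
    using fixed_space_nonconstant[OF assms(1,6)] by blast
  obtain m where n: "n = Suc m" using i by (cases n) auto
  have P: "P \<in> carrier_mat n n" and E: "E \<in> carrier_mat n n"
    using assms(1,2) by (auto simp: row_stochastic_def)
  have A: "row_stochastic n A"
    using assms(1-4) by (auto simp: row_stochastic_def A_def sum.distrib simp flip: sum_distrib_left)
  define CA CP where "CA = map_mat complex_of_real A" and "CP = map_mat complex_of_real P"
  have CA: "CA \<in> carrier_mat (Suc m) (Suc m)" and CP: "CP \<in> carrier_mat (Suc m) (Suc m)"
    using A P n by (auto simp: CA_def CP_def row_stochastic_def)
  define D where "D = deflate m CP"
  have D: "D \<in> carrier_mat m m" by (simp add: D_def)
  have "deflate m CA = of_real c \<cdot>\<^sub>m D"
    using P E n rank_1_row_stochastic_rows_equal[OF assms(2,5), of "Suc _"]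
    by (intro eq_matI) (auto simp: deflate_def D_def CA_def CP_def A_def algebra_simps)
  then have cpA: "char_poly CA = [:-1, 1:] * char_poly (of_real c \<cdot>\<^sub>m D)"
    using char_poly_deflate[OF CA] complex_row_sums[OF A] n by (simp add: CA_def)
  have cpP: "char_poly CP = [:-1, 1:] * char_poly D"
    using char_poly_deflate[OF CP] complex_row_sums[OF assms(1)] n by (simp add: CP_def D_def)
  \<comment> \<open>By \<open>cpP\<close>, each eigenvalue of \<open>D\<close> is one of
    \<open>P\<close>, where the stochastic bound applies.\<close>
  have D_le: "cmod l \<le> 1" if "eigenvalue D l" for l
  proof -
    have "eigenvalue CP l"
      using that cpP by (simp add: eigenvalue_root_char_poly[OF D] eigenvalue_root_char_poly[OF CP])
    then show ?thesis
      using row_stochastic_eigenvalue_norm_le_1[OF assms(1)] by (simp add: CP_def)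
  qed
  have "CP *\<^sub>v map_vec complex_of_real y = map_vec complex_of_real y"
    using y P by (simp add: CP_def flip: of_real_hom.mult_mat_vec_hom)
  then have "eigenvalue D 1"
    unfolding D_def using y i n complex_row_sums[OF assms(1)]
    by (intro eigenvalue_1_deflate[OF CP, of "map_vec complex_of_real y" i]) (auto simp: CP_def)
  then have c_ev: "eigenvalue (of_real c \<cdot>\<^sub>m D) (of_real c)"
    using eigenvalue_smult[OF D] by fastforce
  define q where "q = char_poly (of_real c \<cdot>\<^sub>m D)"
  have q0: "q \<noteq> 0"
    using degree_monic_char_poly[of "of_real c \<cdot>\<^sub>m D" m] D by (auto simp: q_def)
  have root: "x \<in># proots q \<longleftrightarrow> eigenvalue (of_real c \<cdot>\<^sub>m D) x" for x
    using q0 D by (simp add: q_def eigenvalue_root_char_poly[of _ m])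
  have q_le: "cmod x \<le> c" if "x \<in># proots q" for x
    using eigenvalue_smult_norm_le[OF D D_le, of "of_real c" x] that root assms(3) by simp
  have c_in: "complex_of_real c \<in># proots q"
    using c_ev root by blast
  have "proots (char_poly CA) = proots [:-1, 1:] + proots q"
    using cpA q0 proots_mult[of "[:-1, 1:]" q] by (simp add: q_def)
  \<comment> \<open>One copy of 1 is split off as a multiset element, so that \<open>c\<close> still
    occurs among the remaining eigenvalues when \<open>c = 1\<close>.\<close>
  then have evs: "complex_eigenvalues A = add_mset 1 (proots q)"
    by (simp add: complex_eigenvalues_def CA_def)
  have "cmod (ls ! 1) = c" if ord: "eigenvalue_ordering A ls" for ls
  proof -
    obtain ks where ls: "ls = 1 # ks"
      using ord by (cases ls) (auto simp: eigenvalue_ordering_def)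
    have ks: "mset ks = proots q"
      using ord by (simp add: ls eigenvalue_ordering_def evs)
    \<comment> \<open>The second entry \<open>k\<close> has the largest modulus among the roots of
      \<open>q\<close>. Since \<open>c\<close> is such a root and bounds them all,
      \<open>cmod k = c\<close>.\<close>
    obtain k ks' where k: "ks = k # ks'"
      using c_in ks by (cases ks) auto
    have sorted: "cmod x \<le> cmod k" if "x \<in> set ks" for x
      using ord that by (auto simp: ls k eigenvalue_ordering_def)
    have "c \<le> cmod k"
      using sorted[of "of_real c"] c_in ks assms(3) by (metis abs_of_nonneg norm_of_real set_mset_mset)
    moreover have "k \<in># proots q" by (simp add: k flip: ks)
    then have "cmod k \<le> c" by (rule q_le)
    ultimately show ?thesis by (simp add: ls k)
  qed
  moreover have "\<exists>ls. eigenvalue_ordering A ls \<and> ls ! 1 = complex_of_real c"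
  proof -
    \<comment> \<open>One copy of \<open>c\<close> is set aside to follow the leading 1; the negated
      key then sorts the other roots by decreasing modulus.\<close>
    obtain xs where xs: "mset xs = proots q - {#complex_of_real c#}" using ex_mset by blast
    define ks where "ks = sort_key (\<lambda>x. - cmod x) xs"
    have ks: "set ks \<subseteq> set_mset (proots q)"
      using xs by (metis in_diffD ks_def set_mset_mset set_sort subsetI)
    have "sorted_wrt (\<lambda>x y. cmod x \<ge> cmod y) ks"
      using sorted_sort_key[of "\<lambda>x. - cmod x" xs] by (simp add: ks_def sorted_map)
    moreover have "cmod x \<le> c" if "x \<in> set ks" for x
      using that ks q_le by blast
    then have "\<forall>x\<in>set ks. cmod x \<le> c \<and> cmod x \<le> 1"
      using assms(4) by (meson order_trans)
    moreover have "add_mset (complex_of_real c) (mset ks) = proots q"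
      using xs c_in by (simp add: ks_def)
    ultimately have "eigenvalue_ordering A (1 # complex_of_real c # ks)"
      using assms(3,4) by (simp add: eigenvalue_ordering_def evs)
    then show ?thesis by (intro exI[of _ "1 # complex_of_real c # ks"]) simp
  qed
  ultimately show ?thesis by (simp add: A_def)
qed

end
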